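(* The topological Brandt $\lambda^0$-extension $B^0_\lambda(S)$ of a topological monoid $(S,\tau)$ with zero in the class of topological inverse semigroups is countably compact if and only if the cardinal $\lambda\geqslant 1$ is finite and $(S,\tau)$ is a countably compact topological inverse semigroup. Moreover, for any countably compact topological inverse monoid $(S,\tau)$ with zero and for any finite cardinal $\lambda\geqslant 1$ there exists a unique countably compact topological Brandt $\lambda^0$-extension $(B^0_\lambda(S),\tau_B)$ of $(S,\tau)$ in the class of topological inverse semigroups, and the topology $\tau_B$ is generated by the base $\mathscr{B}_B=\bigcup\{\mathscr{B}_B(t): t\in B^0_\lambda(S)\}$, where: (i) $\mathscr{B}_B(t)=\{(U(s))_{\alpha,\beta}\setminus\{0\}: U(s)\in\mathscr{B}_S(s)\}$, when $t=(\alpha,s,\beta)$ is a non-zero element of $B^0_\lambda(S)$, $\alpha,\beta\in I_\lambda$; and (ii) $\mathscr{B}_B(0)=\bigl\{\bigcup_{\alpha,\beta\in I_\lambda}(U(0_S))_{\alpha,\beta}: U(0_S)\in\mathscr{B}_S(0_S)\bigr\}$, when $0$ is the zero of $B^0_\lambda(S)$, and $\mathscr{B}_S(s)$ is a base of the topology $\tau$ at the point $s\in S$.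
   Context: All topological spaces are Hausdorff; a space is countably compact if every countable open cover has a finite subcover. A topological semigroup is a semigroup with a topology making multiplication jointly continuous; a topological inverse semigroup is a topological semigroup that is algebraically an inverse semigroup with continuous inversion. $I_\lambda$ denotes a set of cardinality $\lambda\geqslant 1$. For a monoid $S$ with zero $0_S$, the Brandt $\lambda^0$-extension $B^0_\lambda(S)$ is the set $\{(\alpha,s,\beta):\alpha,\beta\in I_\lambda,\ s\in S\setminus\{0_S\}\}\cup\{0\}$ with multiplication $(\alpha,a,\beta)(\gamma,b,\delta)=(\alpha,ab,\delta)$ if $\beta=\gamma$ and $ab\neq 0_S$, all other products being equal to $0$. For $A\subseteq S$ put $A_{\alpha,\beta}=\{(\alpha,s,\beta):s\in A\}$ if $0_S\notin A$, and $A_{\alpha,\beta}=\{(\alpha,s,\beta):s\in A\setminus\{0_S\}\}\cup\{0\}$ if $0_S\in A$. For a topological monoid $(S,\tau)$ with zero belonging to the class of topological inverse semigroups, a topological Brandt $\lambda^0$-extension of $(S,\tau)$ in the class of topological inverse semigroups is $(B^0_\lambda(S),\tau_B)$ where $\tau_B$ is a topology making $B^0_\lambda(S)$ a topological inverse semigroup and such that for some $\alpha\in I_\lambda$ the subspace topology on $S_{\alpha,\alpha}$ coincides with $\tau$ under the identification $s\mapsto(\alpha,s,\alpha)$, $0_S\mapsto 0$. It is called countably compact if the space $(B^0_\lambda(S),\tau_B)$ is countably compact.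
   Formalization: In the equivalence, the case where S consists only of its zero and λ is infinite is excluded, because then the extension is the one-point space {0}, which is countably compact although λ is infinite. *)

theory Defs
  imports "HOL-Analysis.Analysis" "HOL-Algebra.Group"
begin

section \<open>Topological (inverse) semigroups\<close>

text \<open>The carrier of a topological semigroup is the underlying set of its topology;
  the Hausdorff axiom is part of the definition.\<close>

definition semigroup_on :: "'a set \<Rightarrow> ('a \<Rightarrow> 'a \<Rightarrow> 'a) \<Rightarrow> bool" where
  "semigroup_on A m \<longleftrightarrow>
     (\<forall>x\<in>A. \<forall>y\<in>A. m x y \<in> A) \<and>
     (\<forall>x\<in>A. \<forall>y\<in>A. \<forall>z\<in>A. m (m x y) z = m x (m y z))"

definition is_inverse_on :: "'a set \<Rightarrow> ('a \<Rightarrow> 'a \<Rightarrow> 'a) \<Rightarrow> 'a \<Rightarrow> 'a \<Rightarrow> bool" where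
  "is_inverse_on A m x y \<longleftrightarrow> y \<in> A \<and> m (m x y) x = x \<and> m (m y x) y = y"

definition inverse_semigroup_on :: "'a set \<Rightarrow> ('a \<Rightarrow> 'a \<Rightarrow> 'a) \<Rightarrow> bool" where
  "inverse_semigroup_on A m \<longleftrightarrow>
     semigroup_on A m \<and> (\<forall>x\<in>A. \<exists>!y. is_inverse_on A m x y)"

definition inversion_on :: "'a set \<Rightarrow> ('a \<Rightarrow> 'a \<Rightarrow> 'a) \<Rightarrow> 'a \<Rightarrow> 'a" where
  "inversion_on A m x = (THE y. is_inverse_on A m x y)"

definition topological_semigroup :: "'a topology \<Rightarrow> ('a \<Rightarrow> 'a \<Rightarrow> 'a) \<Rightarrow> bool" where
  "topological_semigroup X m \<longleftrightarrow>
     Hausdorff_space X \<and> semigroup_on (topspace X) m \<and>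
     continuous_map (prod_topology X X) X (\<lambda>(x, y). m x y)"

definition topological_inverse_semigroup :: "'a topology \<Rightarrow> ('a \<Rightarrow> 'a \<Rightarrow> 'a) \<Rightarrow> bool" where
  "topological_inverse_semigroup X m \<longleftrightarrow>
     topological_semigroup X m \<and> inverse_semigroup_on (topspace X) m \<and>
     continuous_map X X (inversion_on (topspace X) m)"

definition countably_compact_space :: "'a topology \<Rightarrow> bool" where
  "countably_compact_space X \<longleftrightarrow>
     (\<forall>\<U>. countable \<U> \<and> (\<forall>U\<in>\<U>. openin X U) \<and> topspace X \<subseteq> \<Union>\<U> \<longrightarrow>
        (\<exists>\<F>. finite \<F> \<and> \<F> \<subseteq> \<U> \<and> topspace X \<subseteq> \<Union>\<F>))"

text \<open>A base at a point consists of open neighbourhoods.\<close>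

definition base_at_point :: "'a topology \<Rightarrow> 'a \<Rightarrow> 'a set set \<Rightarrow> bool" where
  "base_at_point X x \<B> \<longleftrightarrow>
     (\<forall>U\<in>\<B>. openin X U \<and> x \<in> U) \<and>
     (\<forall>V. openin X V \<and> x \<in> V \<longrightarrow> (\<exists>U\<in>\<B>. U \<subseteq> V))"

definition monoid_with_zero :: "('a, 'm) monoid_scheme \<Rightarrow> 'a \<Rightarrow> bool" where
  "monoid_with_zero S z \<longleftrightarrow>
     monoid S \<and> z \<in> carrier S \<and>
     (\<forall>x\<in>carrier S. z \<otimes>\<^bsub>S\<^esub> x = z \<and> x \<otimes>\<^bsub>S\<^esub> z = z)"

definition topological_monoid_with_zero ::
    "('a, 'm) monoid_scheme \<Rightarrow> 'a \<Rightarrow> 'a topology \<Rightarrow> bool" where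
  "topological_monoid_with_zero S z T \<longleftrightarrow>
     monoid_with_zero S z \<and> topspace T = carrier S \<and> topological_semigroup T (mult S)"


section \<open>Brandt extensions\<close>

text \<open>The index set \<open>I\<close> is a set of cardinality \<open>\<lambda>\<close>. A nonzero element \<open>(\<alpha>, s, \<beta>)\<close> is
  \<open>Some (\<alpha>, s, \<beta>)\<close>, and the zero of the extension is \<open>None\<close>; \<open>z\<close> is the zero of \<open>S\<close>.\<close>

type_synonym ('i, 'a) brandt = "('i \<times> 'a \<times> 'i) option"

definition brandt_carrier ::
    "('a, 'm) monoid_scheme \<Rightarrow> 'a \<Rightarrow> 'i set \<Rightarrow> ('i, 'a) brandt set" where
  "brandt_carrier S z I =
     insert None {Some (\<alpha>, s, \<beta>) | \<alpha> s \<beta>. \<alpha> \<in> I \<and> \<beta> \<in> I \<and> s \<in> carrier S - {z}}"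

definition brandt_mult ::
    "('a, 'm) monoid_scheme \<Rightarrow> 'a \<Rightarrow> ('i, 'a) brandt \<Rightarrow> ('i, 'a) brandt \<Rightarrow> ('i, 'a) brandt" where
  "brandt_mult S z x y =
     (case (x, y) of
        (Some (\<alpha>, a, \<beta>), Some (\<gamma>, b, \<delta>)) \<Rightarrow>
          if \<beta> = \<gamma> \<and> a \<otimes>\<^bsub>S\<^esub> b \<noteq> z then Some (\<alpha>, a \<otimes>\<^bsub>S\<^esub> b, \<delta>) else None
      | _ \<Rightarrow> None)"

text \<open>The set written \<open>A\<close> with subscripts \<open>\<alpha>\<close>, \<open>\<beta>\<close>.\<close>

definition brandt_block :: "'a \<Rightarrow> 'a set \<Rightarrow> 'i \<Rightarrow> 'i \<Rightarrow> ('i, 'a) brandt set" where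
  "brandt_block z A \<alpha> \<beta> =
     {Some (\<alpha>, s, \<beta>) | s. s \<in> A - {z}} \<union> (if z \<in> A then {None} else {})"

definition brandt_embed :: "'a \<Rightarrow> 'i \<Rightarrow> 'a \<Rightarrow> ('i, 'a) brandt" where
  "brandt_embed z \<alpha> s = (if s = z then None else Some (\<alpha>, s, \<alpha>))"

text \<open>\<open>TB\<close> is a topological Brandt extension of \<open>(S, T)\<close> in the class of topological inverse
  semigroups; in particular \<open>(S, T)\<close> itself belongs to that class.\<close>

definition topological_brandt_extension ::
    "('a, 'm) monoid_scheme \<Rightarrow> 'a \<Rightarrow> 'a topology \<Rightarrow> 'i set \<Rightarrow> ('i, 'a) brandt topology \<Rightarrow> bool" where
  "topological_brandt_extension S z T I TB \<longleftrightarrow>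
     topological_monoid_with_zero S z T \<and> topological_inverse_semigroup T (mult S) \<and>
     topspace TB = brandt_carrier S z I \<and>
     topological_inverse_semigroup TB (brandt_mult S z) \<and>
     (\<exists>\<alpha>\<in>I. homeomorphic_map T
        (subtopology TB (brandt_block z (carrier S) \<alpha> \<alpha>)) (brandt_embed z \<alpha>))"

text \<open>\<open>\<B> s\<close> is a base of \<open>S\<close> at the point \<open>s\<close>.\<close>

definition brandt_base_at ::
    "'a \<Rightarrow> 'i set \<Rightarrow> ('a \<Rightarrow> 'a set set) \<Rightarrow> ('i, 'a) brandt \<Rightarrow> ('i, 'a) brandt set set" where
  "brandt_base_at z I \<B> t =
     (case t of
        Some (\<alpha>, s, \<beta>) \<Rightarrow> {brandt_block z U \<alpha> \<beta> - {None} | U. U \<in> \<B> s}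
      | None \<Rightarrow> {(\<Union>\<alpha>\<in>I. \<Union>\<beta>\<in>I. brandt_block z U \<alpha> \<beta>) | U. U \<in> \<B> z})"

definition brandt_base ::
    "('a, 'm) monoid_scheme \<Rightarrow> 'a \<Rightarrow> 'i set \<Rightarrow> ('a \<Rightarrow> 'a set set) \<Rightarrow> ('i, 'a) brandt set set" where
  "brandt_base S z I \<B> = (\<Union>t\<in>brandt_carrier S z I. brandt_base_at z I \<B> t)"

end

theory Submission
  imports Defs
begin

text \<open>If \<open>I\<close> were infinite, a cluster point \<open>x\<close> of distinct elements
  \<open>x\<^sub>n = (\<alpha>, 1, \<beta>\<^sub>n)\<close> would contradict continuity of \<open>(x, y) \<mapsto> x y\<inverse>\<close> at \<open>(x, x)\<close>, because
  \<open>x\<^sub>n x\<^sub>m\<inverse>\<close> is \<open>(\<alpha>, 1, \<alpha>)\<close> for \<open>n = m\<close> and \<open>0\<close> otherwise.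
  Translations by the elements \<open>(\<alpha>, 1, \<beta>)\<close> show that every map \<open>s \<mapsto> (\<alpha>, s, \<beta>)\<close> is a closed
  embedding of \<open>S\<close>. For finite \<open>I\<close> the extension is the union of finitely many such blocks, so a
  set is open iff its trace on every block is open in \<open>S\<close>. This determines the topology and its
  base, and conversely the topology so described makes the extension a topological inverse
  semigroup, since the operations can be pasted together from the finitely many closed blocks.\<close>

section \<open>Countably compact spaces\<close>

lemma countably_compact_spaceE:
  assumes "countably_compact_space X"
    and "countable \<U>" "\<forall>U\<in>\<U>. openin X U" "topspace X \<subseteq> \<Union>\<U>"
  obtains \<F> where "finite \<F>" "\<F> \<subseteq> \<U>" "topspace X \<subseteq> \<Union>\<F>"
  using assms(1)[unfolded countably_compact_space_def, THEN spec, THEN mp, OF conjI[OF assms(2) conjI[OF assms(3,4)]]]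
  by (elim exE conjE)

text \<open>Pulling a cover back along each \<open>f j\<close> yields a finite subfamily for that
  \<open>j\<close>, and finitely many \<open>j\<close> keep the union of these subfamilies finite.
  Applied to the maps \<open>el \<alpha> \<beta>\<close>, this carries countable compactness from
  \<open>S\<close> to a finite extension.\<close>

lemma countably_compact_space_finite_cover:
  assumes X: "countably_compact_space X" and J: "finite J"
    and cont: "\<And>j. j \<in> J \<Longrightarrow> continuous_map X Y (f j)"
    and cover: "topspace Y \<subseteq> (\<Union>j\<in>J. f j ` topspace X)"
  shows "countably_compact_space Y"
  unfolding countably_compact_space_def
proof (intro allI impI, elim conjE)
  fix \<U> assume \<U>: "countable \<U>" "\<forall>U\<in>\<U>. openin Y U" "topspace Y \<subseteq> \<Union>\<U>"
  have "\<exists>\<F>. finite \<F> \<and> \<F> \<subseteq> \<U> \<and> f j ` topspace X \<subseteq> \<Union>\<F>" if j: "j \<in> J" for j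
  proof -
    let ?pre = "\<lambda>U. {x \<in> topspace X. f j x \<in> U}"
    have "countable (?pre ` \<U>)" using \<U>(1) by simp
    moreover have "\<forall>V\<in>?pre ` \<U>. openin X V"
      using \<U>(2) cont[OF j] by (auto simp: continuous_map)
    moreover have "topspace X \<subseteq> \<Union>(?pre ` \<U>)"
      using \<U>(3) continuous_map_image_subset_topspace[OF cont[OF j]] by blast
    ultimately obtain \<G> where \<G>: "finite \<G>" "\<G> \<subseteq> ?pre ` \<U>" and cov: "topspace X \<subseteq> \<Union>\<G>"
      by (rule countably_compact_spaceE[OF X])
    obtain \<F> where "finite \<F>" "\<F> \<subseteq> \<U>" "\<G> = ?pre ` \<F>"
      using finite_subset_image[OF \<G>] by metis
    then show ?thesis using cov by (intro exI[of _ \<F>]) auto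
  qed
  then obtain \<F> where \<F>: "\<And>j. j \<in> J \<Longrightarrow> finite (\<F> j) \<and> \<F> j \<subseteq> \<U> \<and> f j ` topspace X \<subseteq> \<Union>(\<F> j)"
    by metis
  show "\<exists>\<F>. finite \<F> \<and> \<F> \<subseteq> \<U> \<and> topspace Y \<subseteq> \<Union>\<F>"
  proof (intro exI conjI)
    show "finite (\<Union>j\<in>J. \<F> j)" using J \<F> by simp
    show "(\<Union>j\<in>J. \<F> j) \<subseteq> \<U>" by (rule UN_least) (use \<F> in simp)
    have "f j ` topspace X \<subseteq> \<Union>(\<Union>j\<in>J. \<F> j)" if "j \<in> J" for j
      using \<F>[OF that] that by blast
    then show "topspace Y \<subseteq> \<Union>(\<Union>j\<in>J. \<F> j)" using cover by (meson UN_least order_trans)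
  qed
qed

lemma countably_compact_space_closed_embedding:
  assumes Y: "countably_compact_space Y"
    and f: "closed_map X Y f" and inj: "inj_on f (topspace X)"
  shows "countably_compact_space X"
  unfolding countably_compact_space_def
proof (intro allI impI, elim conjE)
  fix \<U> assume \<U>: "countable \<U>" "\<forall>U\<in>\<U>. openin X U" "topspace X \<subseteq> \<Union>\<U>"
  show "\<exists>\<F>. finite \<F> \<and> \<F> \<subseteq> \<U> \<and> topspace X \<subseteq> \<Union>\<F>"
  proof (cases "\<U> = {}")
    case True
    then show ?thesis using \<U>(3) by blast
  next
    case False
    \<comment> \<open>Points of \<open>Y\<close> outside the image of \<open>f\<close> lie in every
      \<open>?W U\<close>; they are covered as soon as some \<open>U\<close> exists, which is why
      the empty cover is split off.\<close>
    let ?W = "\<lambda>U. topspace Y - f ` (topspace X - U)"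
    have "countable (?W ` \<U>)" using \<U>(1) by simp
    moreover have "\<forall>V\<in>?W ` \<U>. openin Y V"
      using \<U>(2) f closedin_diff[OF closedin_topspace] openin_diff[OF openin_topspace]
      unfolding closed_map_def by blast
    moreover have "topspace Y \<subseteq> \<Union>(?W ` \<U>)"
    proof
      fix y assume y: "y \<in> topspace Y"
      show "y \<in> \<Union>(?W ` \<U>)"
      proof (cases "y \<in> f ` topspace X")
        case True
        then obtain x U where "x \<in> topspace X" "y = f x" "U \<in> \<U>" "x \<in> U" using \<U>(3) by blast
        then have "y \<in> ?W U" using y inj by (auto dest: inj_onD)
        then show ?thesis using \<open>U \<in> \<U>\<close> by blast
      next
        case False
        then show ?thesis using y \<open>\<U> \<noteq> {}\<close> by blast
      qed
    qed
    ultimately obtain \<G> where \<G>: "finite \<G>" "\<G> \<subseteq> ?W ` \<U>" and cov: "topspace Y \<subseteq> \<Union>\<G>"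
      by (rule countably_compact_spaceE[OF Y])
    obtain \<F> where \<F>: "finite \<F>" "\<F> \<subseteq> \<U>" "\<G> = ?W ` \<F>"
      using finite_subset_image[OF \<G>] by metis
    have "f ` topspace X \<subseteq> topspace Y"
      using f closedin_subset unfolding closed_map_def by (metis closedin_topspace)
    then have "topspace X \<subseteq> \<Union>\<F>" using cov \<F>(3) by blast
    then show ?thesis using \<F> by blast
  qed
qed

text \<open>If the closures of the tails had no common point, finitely many of their complements
  would cover \<open>X\<close>; but a late enough term lies in all the corresponding tails.\<close>

lemma countably_compact_space_cluster_point:
  fixes f :: "nat \<Rightarrow> 'a"
  assumes X: "countably_compact_space X" and f: "range f \<subseteq> topspace X"
  obtains x where "x \<in> topspace X"
    and "\<And>V k. openin X V \<Longrightarrow> x \<in> V \<Longrightarrow> \<exists>n\<ge>k. f n \<in> V"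
proof -
  let ?C = "\<lambda>k. X closure_of (f ` {k..})"
  have "\<exists>x\<in>topspace X. \<forall>k. x \<in> ?C k"
  proof (rule ccontr)
    assume "\<not> ?thesis"
    then have cov: "topspace X \<subseteq> \<Union>(range (\<lambda>k. topspace X - ?C k))" by blast
    have "countable (range (\<lambda>k. topspace X - ?C k))" by simp
    moreover have "\<forall>U\<in>range (\<lambda>k. topspace X - ?C k). openin X U" by auto
    ultimately obtain \<G> where "finite \<G>" "\<G> \<subseteq> range (\<lambda>k. topspace X - ?C k)" "topspace X \<subseteq> \<Union>\<G>"
      using cov
      by (rule countably_compact_spaceE[OF X])
    then obtain K where K: "finite K" "topspace X \<subseteq> (\<Union>k\<in>K. topspace X - ?C k)"
      by (metis finite_subset_image)
    obtain m where m: "\<forall>k\<in>K. k \<le> m" using K(1) finite_nat_set_iff_bounded_le by blast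
    obtain k where k: "k \<in> K" "f m \<notin> ?C k" using K(2) f by blast
    have "f m \<in> f ` {k..}" using m k(1) by auto
    moreover have "f ` {k..} \<subseteq> ?C k" using f by (intro closure_of_subset) auto
    ultimately show False using k(2) by blast
  qed
  then obtain x where x: "x \<in> topspace X" "\<And>k. x \<in> ?C k" by blast
  show thesis
  proof (rule that[OF x(1)])
    fix V k assume "openin X V" "x \<in> V"
    then show "\<exists>n\<ge>k. f n \<in> V" using x(2)[of k] by (auto simp: in_closure_of)
  qed
qed

section \<open>Topological inverse semigroups\<close>

lemma continuous_map_semigroup_mult:
  assumes "topological_semigroup X m" "continuous_map Y X f" "continuous_map Y X g"
  shows "continuous_map Y X (\<lambda>y. m (f y) (g y))"
proof -
  have "continuous_map (prod_topology X X) X (\<lambda>(x, y). m x y)"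
    using assms(1) by (simp add: topological_semigroup_def)
  from continuous_map_compose[OF continuous_map_pairedI[OF assms(2,3)] this]
  show ?thesis by (simp add: o_def)
qed

lemma is_inverse_on_inversion_on:
  assumes "inverse_semigroup_on A m" "x \<in> A"
  shows "is_inverse_on A m x (inversion_on A m x)"
  using assms unfolding inverse_semigroup_on_def inversion_on_def by (metis theI')

lemma inversion_on_eqI:
  assumes "inverse_semigroup_on A m" "x \<in> A" "is_inverse_on A m x y"
  shows "inversion_on A m x = y"
  using assms is_inverse_on_inversion_on[OF assms(1,2)] unfolding inverse_semigroup_on_def by blast

section \<open>Algebra of Brandt extensions\<close>

text \<open>Sending \<open>z\<close> to \<open>None\<close> makes this a map on all of
  \<open>S\<close>, so that each block is simply an image and zero products need no special
  treatment.\<close>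

definition brandt_elem :: "'a \<Rightarrow> 'i \<Rightarrow> 'i \<Rightarrow> 'a \<Rightarrow> ('i, 'a) brandt" where
  "brandt_elem z \<alpha> \<beta> s = (if s = z then None else Some (\<alpha>, s, \<beta>))"

text \<open>A left inverse of \<open>brandt_elem z \<alpha> \<beta>\<close>; the default
  \<open>z\<close> off the block makes \<open>brandt_elem\<close> after \<open>brandt_coord\<close>
  a retraction of the extension onto that block.\<close>

definition brandt_coord :: "'a \<Rightarrow> 'i \<Rightarrow> 'i \<Rightarrow> ('i, 'a) brandt \<Rightarrow> 'a" where
  "brandt_coord z \<alpha> \<beta> x =
     (case x of None \<Rightarrow> z | Some (\<gamma>, s, \<delta>) \<Rightarrow> if \<gamma> = \<alpha> \<and> \<delta> = \<beta> then s else z)"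

lemma brandt_embed_eq: "brandt_embed z \<alpha> = brandt_elem z \<alpha> \<alpha>"
  by (auto simp: brandt_embed_def brandt_elem_def fun_eq_iff)

lemma brandt_elem_zero [simp]: "brandt_elem z \<alpha> \<beta> z = None"
  by (simp add: brandt_elem_def)

lemma brandt_elem_eq_iff:
  "brandt_elem z \<alpha> \<beta> s = brandt_elem z \<gamma> \<delta> t \<longleftrightarrow> s = t \<and> (s = z \<or> \<alpha> = \<gamma> \<and> \<beta> = \<delta>)"
  by (auto simp: brandt_elem_def)

lemma brandt_elem_eq_None [simp]:
  "brandt_elem z \<alpha> \<beta> s = None \<longleftrightarrow> s = z"
  "None = brandt_elem z \<alpha> \<beta> s \<longleftrightarrow> s = z"
  by (simp_all add: brandt_elem_def)

lemma brandt_coord_elem: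
  "brandt_coord z \<alpha> \<beta> (brandt_elem z \<gamma> \<delta> s) = (if \<gamma> = \<alpha> \<and> \<delta> = \<beta> then s else z)"
  by (simp add: brandt_elem_def brandt_coord_def)

lemma brandt_block_eq: "brandt_block z A \<alpha> \<beta> = brandt_elem z \<alpha> \<beta> ` A"
  by (auto simp: brandt_block_def brandt_elem_def image_iff)

locale monoid_zero =
  fixes S :: "('a, 'm) monoid_scheme" and z :: 'a and I :: "'i set"
  assumes mz: "monoid_with_zero S z" and I: "I \<noteq> {}"
begin

abbreviation "B \<equiv> brandt_carrier S z I"
abbreviation "bm \<equiv> brandt_mult S z"
abbreviation "el \<equiv> (brandt_elem z :: 'i \<Rightarrow> 'i \<Rightarrow> 'a \<Rightarrow> ('i, 'a) brandt)"
abbreviation "co \<equiv> (brandt_coord z :: 'i \<Rightarrow> 'i \<Rightarrow> ('i, 'a) brandt \<Rightarrow> 'a)"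

sublocale monoid S
  using mz by (simp add: monoid_with_zero_def)

lemma zero_closed [simp]: "z \<in> carrier S"
  and zero_left [simp]: "x \<in> carrier S \<Longrightarrow> z \<otimes>\<^bsub>S\<^esub> x = z"
  and zero_right [simp]: "x \<in> carrier S \<Longrightarrow> x \<otimes>\<^bsub>S\<^esub> z = z"
  using mz by (simp_all add: monoid_with_zero_def)

lemma elem_closed: "\<alpha> \<in> I \<Longrightarrow> \<beta> \<in> I \<Longrightarrow> s \<in> carrier S \<Longrightarrow> el \<alpha> \<beta> s \<in> B"
  by (auto simp: brandt_elem_def brandt_carrier_def)

lemma coord_closed: "x \<in> B \<Longrightarrow> co \<alpha> \<beta> x \<in> carrier S"
  by (auto simp: brandt_coord_def brandt_carrier_def)

text \<open>Zero is covered too, as \<open>el \<alpha> \<beta> z\<close> with arbitrary indices;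
  these exist because \<open>I\<close> is nonempty.\<close>

lemma brandt_carrierE:
  assumes "x \<in> B"
  obtains \<alpha> s \<beta> where "\<alpha> \<in> I" "\<beta> \<in> I" "s \<in> carrier S" "x = el \<alpha> \<beta> s"
proof (cases x)
  case None
  with I that[of _ _ z] show ?thesis by auto
next
  case (Some p)
  with assms obtain \<alpha> s \<beta> where "x = Some (\<alpha>, s, \<beta>)" "\<alpha> \<in> I" "\<beta> \<in> I" "s \<in> carrier S - {z}"
    by (auto simp: brandt_carrier_def)
  then show ?thesis using that[of \<alpha> \<beta> s] by (auto simp: brandt_elem_def)
qed

lemma mult_elem:
  assumes "a \<in> carrier S" "b \<in> carrier S"
  shows "bm (el \<alpha> \<beta> a) (el \<gamma> \<delta> b) = (if \<beta> = \<gamma> then el \<alpha> \<delta> (a \<otimes>\<^bsub>S\<^esub> b) else None)"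
  using assms by (auto simp: brandt_elem_def brandt_mult_def)

lemma mult_None [simp]: "bm None x = None" "bm x None = None"
  by (auto simp: brandt_mult_def split: option.split)

lemma semigroup_on_brandt: "semigroup_on B bm"
  unfolding semigroup_on_def
proof (intro conjI ballI)
  have None: "None \<in> B" by (simp add: brandt_carrier_def)
  fix x y assume "x \<in> B" "y \<in> B"
  then show "bm x y \<in> B"
    by (auto elim!: brandt_carrierE simp: mult_elem elem_closed None)
next
  fix x y w assume "x \<in> B" "y \<in> B" "w \<in> B"
  then show "bm (bm x y) w = bm x (bm y w)"
    by (auto elim!: brandt_carrierE simp: mult_elem m_assoc)
qed

lemma is_inverse_on_elem:
  assumes "\<alpha> \<in> I" "\<beta> \<in> I" "s \<in> carrier S" "is_inverse_on (carrier S) (mult S) s t"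
  shows "is_inverse_on B bm (el \<alpha> \<beta> s) (el \<beta> \<alpha> t)"
  using assms by (auto simp: is_inverse_on_def mult_elem elem_closed)

text \<open>The inverse swaps the indices and inverts the middle entry in \<open>S\<close>.
  Uniqueness reduces to that in \<open>S\<close> once the indices of a second inverse are known to
  match.\<close>

lemma inverse_semigroup_on_brandt:
  assumes inv: "inverse_semigroup_on (carrier S) (mult S)"
  shows "inverse_semigroup_on B bm"
  unfolding inverse_semigroup_on_def
proof (intro conjI ballI semigroup_on_brandt)
  fix x assume "x \<in> B"
  then obtain \<alpha> s \<beta> where x: "\<alpha> \<in> I" "\<beta> \<in> I" "s \<in> carrier S" "x = el \<alpha> \<beta> s"
    by (rule brandt_carrierE)
  obtain t where t: "is_inverse_on (carrier S) (mult S) s t"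
    and uniq: "\<And>u. is_inverse_on (carrier S) (mult S) s u \<Longrightarrow> u = t"
    using inv x(3) unfolding inverse_semigroup_on_def by blast
  show "\<exists>!y. is_inverse_on B bm x y"
  proof (rule ex1I)
    show "is_inverse_on B bm x (el \<beta> \<alpha> t)"
      using is_inverse_on_elem[OF x(1-3) t] x(4) by simp
    fix y assume y: "is_inverse_on B bm x y"
    then have "y \<in> B" by (simp add: is_inverse_on_def)
    then obtain \<gamma> u \<delta> where u: "\<gamma> \<in> I" "\<delta> \<in> I" "u \<in> carrier S" "y = el \<gamma> \<delta> u"
      by (rule brandt_carrierE)
    show "y = el \<beta> \<alpha> t"
    proof (cases "s = z")
      case True
      \<comment> \<open>Zero is its own only inverse: the products \<open>t s t = t\<close> and
        \<open>y x y = y\<close> both collapse.\<close>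
      then have "t = z" using t by (auto simp: is_inverse_on_def)
      moreover have "y = None" using y True x(4) by (auto simp: is_inverse_on_def)
      ultimately show ?thesis by simp
    next
      case False
      then have "x \<noteq> None" using x(4) by simp
      \<comment> \<open>Since \<open>x y x = x\<close> is nonzero, neither multiplication may meet
        mismatched indices.\<close>
      then have idx: "\<gamma> = \<beta>" "\<delta> = \<alpha>"
        using y x u by (auto simp: is_inverse_on_def mult_elem split: if_splits)
      have "s \<otimes>\<^bsub>S\<^esub> u \<otimes>\<^bsub>S\<^esub> s = s" "u \<otimes>\<^bsub>S\<^esub> s \<otimes>\<^bsub>S\<^esub> u = u"
        using y x u idx by (auto simp: is_inverse_on_def mult_elem brandt_elem_eq_iff)
      then have "u = t" using uniq u(3) by (simp add: is_inverse_on_def)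
      then show ?thesis using u idx by simp
    qed
  qed
qed

lemma inversion_on_elem:
  assumes "inverse_semigroup_on (carrier S) (mult S)" "\<alpha> \<in> I" "\<beta> \<in> I" "s \<in> carrier S"
  shows "inversion_on B bm (el \<alpha> \<beta> s) = el \<beta> \<alpha> (inversion_on (carrier S) (mult S) s)"
  using assms
  by (intro inversion_on_eqI inverse_semigroup_on_brandt is_inverse_on_elem elem_closed
      is_inverse_on_inversion_on)

end

section \<open>The topology of a finite Brandt extension\<close>

text \<open>The final topology on the extension for the maps
  \<open>brandt_elem z \<alpha> \<beta>\<close>. The same predicate serves to identify the topology
  of a given extension and to construct one.\<close>

definition brandt_open ::
    "('a, 'm) monoid_scheme \<Rightarrow> 'a \<Rightarrow> 'a topology \<Rightarrow> 'i set \<Rightarrow> ('i, 'a) brandt set \<Rightarrow> bool" where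
  "brandt_open S z T I V \<longleftrightarrow> V \<subseteq> brandt_carrier S z I \<and>
     (\<forall>\<alpha>\<in>I. \<forall>\<beta>\<in>I. openin T {s \<in> carrier S. brandt_elem z \<alpha> \<beta> s \<in> V})"

locale brandt_extension = monoid_zero S z I
  for S :: "('a, 'm) monoid_scheme" and z :: 'a and I :: "'i set" +
  fixes T :: "'a topology" and TB :: "('i, 'a) brandt topology" and \<alpha>0 :: 'i
  assumes T: "topspace T = carrier S"
    and TB: "topspace TB = brandt_carrier S z I"
    and TIS: "topological_inverse_semigroup TB (brandt_mult S z)"
    and \<alpha>0: "\<alpha>0 \<in> I"
    and hom: "homeomorphic_map T
        (subtopology TB (brandt_block z (carrier S) \<alpha>0 \<alpha>0)) (brandt_embed z \<alpha>0)"
begin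

section \<open>Blocks as closed copies of \<open>S\<close>\<close>

lemma TS: "topological_semigroup TB bm"
  using TIS by (simp add: topological_inverse_semigroup_def)

lemma Hausdorff: "Hausdorff_space TB"
  using TS by (simp add: topological_semigroup_def)

lemma continuous_translations:
  assumes "a \<in> B" "b \<in> B"
  shows "continuous_map TB TB (\<lambda>x. bm (bm a x) b)"
  using assms TB by (intro continuous_map_semigroup_mult[OF TS]) auto

text \<open>With \<open>e = (\<alpha>0, 1, \<alpha>0)\<close>, the corner block is the fixed-point
  set of \<open>x \<mapsto> e x e\<close>, hence closed in a Hausdorff space; a homeomorphism onto a
  closed subspace is a closed map.\<close>

lemma closed_map_corner: "closed_map T TB (el \<alpha>0 \<alpha>0)"
proof -
  let ?e = "el \<alpha>0 \<alpha>0 \<one>\<^bsub>S\<^esub>"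
  let ?C = "brandt_block z (carrier S) \<alpha>0 \<alpha>0"
  have e: "?e \<in> B" using \<alpha>0 by (simp add: elem_closed)
  have "x \<in> ?C \<longleftrightarrow> bm (bm ?e x) ?e = x" if "x \<in> B" for x
    using that \<alpha>0
    by (auto elim!: brandt_carrierE simp: brandt_block_eq mult_elem image_iff brandt_elem_eq_iff
        split: if_splits)
  moreover have "?C \<subseteq> B" using \<alpha>0 by (auto simp: brandt_block_eq elem_closed)
  ultimately have eq: "?C = {x \<in> topspace TB. bm (bm ?e x) ?e = x}" using TB by blast
  have "closedin TB ?C"
    unfolding eq
    by (intro closedin_continuous_maps_eq[OF Hausdorff] continuous_translations e) simp
  moreover have "closed_map T (subtopology TB ?C) (el \<alpha>0 \<alpha>0)"
    using hom homeomorphic_imp_closed_map by (simp add: brandt_embed_eq)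
  ultimately show ?thesis
    unfolding closed_map_def by (meson closedin_trans_full)
qed

text \<open>Follows from \<open>(\<alpha>, s, \<beta>) = (\<alpha>, 1, \<alpha>0) (\<alpha>0, s,
  \<alpha>0) (\<alpha>0, 1, \<beta>)\<close>, which moves the corner block to any other by
  translations.\<close>

lemma continuous_elem:
  assumes "\<alpha> \<in> I" "\<beta> \<in> I"
  shows "continuous_map T TB (el \<alpha> \<beta>)"
proof -
  have "continuous_map T TB (el \<alpha>0 \<alpha>0)"
    using homeomorphic_imp_continuous_map[OF hom]
    by (simp add: brandt_embed_eq continuous_map_in_subtopology)
  moreover have "continuous_map TB TB (\<lambda>x. bm (bm (el \<alpha> \<alpha>0 \<one>\<^bsub>S\<^esub>) x) (el \<alpha>0 \<beta> \<one>\<^bsub>S\<^esub>))"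
    using assms \<alpha>0 by (intro continuous_translations) (auto simp: elem_closed)
  ultimately have "continuous_map T TB ((\<lambda>x. bm (bm (el \<alpha> \<alpha>0 \<one>\<^bsub>S\<^esub>) x) (el \<alpha>0 \<beta> \<one>\<^bsub>S\<^esub>)) \<circ> el \<alpha>0 \<alpha>0)"
    by (rule continuous_map_compose)
  then show ?thesis
    by (rule continuous_map_eq) (simp add: T mult_elem)
qed

text \<open>The map \<open>?f\<close> fixes exactly the block at \<open>\<alpha>, \<beta>\<close>,
  and \<open>?g\<close> carries that block back to the corner. The image of \<open>C\<close> is
  therefore the fixed-point set of \<open>?f\<close> intersected with a preimage under
  \<open>?g\<close> of a closed set.\<close>

lemma closed_map_elem:
  assumes "\<alpha> \<in> I" "\<beta> \<in> I"
  shows "closed_map T TB (el \<alpha> \<beta>)"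
  unfolding closed_map_def
proof (intro allI impI)
  fix C assume C: "closedin T C"
  then have CS: "C \<subseteq> carrier S" using T closedin_subset by blast
  let ?f = "\<lambda>x. bm (bm (el \<alpha> \<alpha> \<one>\<^bsub>S\<^esub>) x) (el \<beta> \<beta> \<one>\<^bsub>S\<^esub>)"
  let ?g = "\<lambda>x. bm (bm (el \<alpha>0 \<alpha> \<one>\<^bsub>S\<^esub>) x) (el \<beta> \<alpha>0 \<one>\<^bsub>S\<^esub>)"
  have f: "continuous_map TB TB ?f" and g: "continuous_map TB TB ?g"
    using assms \<alpha>0 by (auto intro!: continuous_translations simp: elem_closed)
  have "x \<in> el \<alpha> \<beta> ` C \<longleftrightarrow> ?f x = x \<and> ?g x \<in> el \<alpha>0 \<alpha>0 ` C" if "x \<in> B" for x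
    using that CS
    by (auto elim!: brandt_carrierE simp: mult_elem image_iff brandt_elem_eq_iff subset_eq
        split: if_splits)
  moreover have "el \<alpha> \<beta> ` C \<subseteq> B" using assms CS by (auto simp: elem_closed)
  ultimately have "el \<alpha> \<beta> ` C =
      {x \<in> topspace TB. ?f x = x} \<inter> {x \<in> topspace TB. ?g x \<in> el \<alpha>0 \<alpha>0 ` C}"
    using TB by blast
  moreover have "closedin TB {x \<in> topspace TB. ?f x = x}"
    by (intro closedin_continuous_maps_eq[OF Hausdorff] f) simp
  moreover have "closedin TB {x \<in> topspace TB. ?g x \<in> el \<alpha>0 \<alpha>0 ` C}"
    using closedin_continuous_map_preimage[OF g] closed_map_corner C
    unfolding closed_map_def by blast
  ultimately show "closedin TB (el \<alpha> \<beta> ` C)"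
    by (simp add: closedin_Int)
qed

text \<open>The right-hand side does not mention \<open>TB\<close>, so any two extensions of
  \<open>(S, T)\<close> over a finite \<open>I\<close> have the same topology.\<close>

lemma openin_iff_brandt_open:
  assumes fin: "finite I"
  shows "openin TB V \<longleftrightarrow> brandt_open S z T I V"
proof
  assume V: "openin TB V"
  then have "V \<subseteq> B" using TB openin_subset by blast
  moreover have "openin T {s \<in> carrier S. el \<alpha> \<beta> s \<in> V}" if "\<alpha> \<in> I" "\<beta> \<in> I" for \<alpha> \<beta>
    using openin_continuous_map_preimage[OF continuous_elem[OF that] V] T by simp
  ultimately show "brandt_open S z T I V" by (simp add: brandt_open_def)
next
  assume V: "brandt_open S z T I V"
  let ?P = "\<lambda>\<alpha> \<beta>. {s \<in> carrier S. el \<alpha> \<beta> s \<in> V}"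
  have "closedin TB (el \<alpha> \<beta> ` (carrier S - ?P \<alpha> \<beta>))" if "\<alpha> \<in> I" "\<beta> \<in> I" for \<alpha> \<beta>
    using closed_map_elem[OF that] V that unfolding closed_map_def brandt_open_def
    by (metis T closedin_diff closedin_topspace)
  \<comment> \<open>Finiteness of \<open>I\<close> enters here: the complement of \<open>V\<close>
    is a finite union of closed pieces, one per block.\<close>
  then have "closedin TB (\<Union>\<alpha>\<in>I. \<Union>\<beta>\<in>I. el \<alpha> \<beta> ` (carrier S - ?P \<alpha> \<beta>))"
    using fin by (intro closedin_Union) (auto intro!: closedin_Union)
  also have "(\<Union>\<alpha>\<in>I. \<Union>\<beta>\<in>I. el \<alpha> \<beta> ` (carrier S - ?P \<alpha> \<beta>)) = topspace TB - V"
  proof (intro equalityI subsetI)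
    fix x assume "x \<in> topspace TB - V"
    then have x: "x \<in> B" "x \<notin> V" using TB by auto
    from x(1) obtain \<alpha> s \<beta> where "\<alpha> \<in> I" "\<beta> \<in> I" "s \<in> carrier S" "x = el \<alpha> \<beta> s"
      by (rule brandt_carrierE)
    then show "x \<in> (\<Union>\<alpha>\<in>I. \<Union>\<beta>\<in>I. el \<alpha> \<beta> ` (carrier S - ?P \<alpha> \<beta>))"
      using x(2) by blast
  qed (auto simp: TB elem_closed)
  finally show "openin TB V"
    using V TB by (simp add: openin_closedin_eq brandt_open_def)
qed

text \<open>For \<open>carrier S = {z}\<close> the extension is the single point \<open>None\<close>
  whatever \<open>I\<close> is; otherwise \<open>1\<close> differs from \<open>z\<close>, which
  separates \<open>(\<alpha>0, 1, \<alpha>0)\<close> from zero.\<close>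

lemma finite_if_countably_compact:
  assumes cc: "countably_compact_space TB" and nontriv: "carrier S \<noteq> {z}"
  shows "finite I"
proof (rule ccontr)
  assume "infinite I"
  then obtain b :: "nat \<Rightarrow> 'i" where b: "inj b" "range b \<subseteq> I"
    using infinite_countable_subset by blast
  have one: "\<one>\<^bsub>S\<^esub> \<noteq> z"
  proof
    assume "\<one>\<^bsub>S\<^esub> = z"
    then have "x = z" if "x \<in> carrier S" for x
      using that by (metis l_one zero_left)
    then show False using nontriv zero_closed by blast
  qed
  let ?x = "\<lambda>n. el \<alpha>0 (b n) \<one>\<^bsub>S\<^esub>" and ?e = "el \<alpha>0 \<alpha>0 \<one>\<^bsub>S\<^esub>"
  let ?inv = "inversion_on B bm"
  have inv: "inverse_semigroup_on B bm" and cinv: "continuous_map TB TB ?inv"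
    using TIS TB by (auto simp: topological_inverse_semigroup_def)
  have bI: "b n \<in> I" for n using b(2) by blast
  then have xB: "?x n \<in> B" for n using \<alpha>0 by (simp add: elem_closed)
  have "?inv (?x n) = el (b n) \<alpha>0 \<one>\<^bsub>S\<^esub>" for n
    using bI \<alpha>0 by (intro inversion_on_eqI[OF inv xB] is_inverse_on_elem) (auto simp: is_inverse_on_def)
  then have prod: "bm (?x n) (?inv (?x m)) = (if n = m then ?e else None)" for n m
    using b by (auto simp: mult_elem inj_eq)
  let ?F = "\<lambda>(x, y). bm x (?inv y)"
  have F: "continuous_map (prod_topology TB TB) TB ?F"
    using continuous_map_semigroup_mult[OF TS continuous_map_fst continuous_map_compose[OF continuous_map_snd cinv]]
    by (simp add: case_prod_unfold o_def)
  obtain x where x: "x \<in> topspace TB"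
    and clus: "\<And>V k. openin TB V \<Longrightarrow> x \<in> V \<Longrightarrow> \<exists>n\<ge>k. ?x n \<in> V"
    using countably_compact_space_cluster_point[OF cc, of ?x] xB TB by blast
  \<comment> \<open>Products of sequence terms near \<open>x\<close> take both values
    \<open>?e\<close> and \<open>None\<close>, so both lie in every neighbourhood of the value of
    \<open>?F\<close> at \<open>(x, x)\<close>.\<close>
  have near: "?e \<in> W \<and> None \<in> W" if W: "openin TB W" "?F (x, x) \<in> W" for W
  proof -
    have "openin (prod_topology TB TB) {p \<in> topspace (prod_topology TB TB). ?F p \<in> W}"
      using openin_continuous_map_preimage[OF F W(1)] .
    moreover have "(x, x) \<in> {p \<in> topspace (prod_topology TB TB). ?F p \<in> W}"
      using x W(2) by simp
    ultimately obtain U V where UV: "openin TB U" "openin TB V" "x \<in> U" "x \<in> V"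
      and sub: "U \<times> V \<subseteq> {p \<in> topspace (prod_topology TB TB). ?F p \<in> W}"
      unfolding openin_prod_topology_alt by meson
    have "openin TB (U \<inter> V)" "x \<in> U \<inter> V" using UV by auto
    \<comment> \<open>Starting the second search at \<open>Suc n\<close> guarantees
      \<open>m \<noteq> n\<close>.\<close>
    then obtain n m where n: "?x n \<in> U \<inter> V" and m: "m \<ge> Suc n" "?x m \<in> U \<inter> V"
      using clus by meson
    have "?F (?x n, ?x n) \<in> W" "?F (?x n, ?x m) \<in> W" using n m(2) sub by blast+
    then show ?thesis using m(1) by (simp add: prod)
  qed
  have p: "?F (x, x) \<in> topspace TB"
    using continuous_map_image_subset_topspace[OF F] x by auto
  \<comment> \<open>In a Hausdorff space a point lying in all open neighbourhoods of another equals
    it; this is applied to both \<open>?e\<close> and \<open>None\<close>.\<close>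
  have eq: "?F (x, x) = y" if "y \<in> topspace TB" "\<And>W. openin TB W \<Longrightarrow> ?F (x, x) \<in> W \<Longrightarrow> y \<in> W" for y
    using Hausdorff p that unfolding Hausdorff_space_def disjnt_iff by metis
  have "?F (x, x) = ?e" using near \<alpha>0 by (intro eq) (auto simp: TB elem_closed)
  moreover have "?F (x, x) = None" using near by (intro eq) (auto simp: TB brandt_carrier_def)
  ultimately show False using one by simp
qed

section \<open>Countable compactness of \<open>S\<close> against that of the extension, and the
  base\<close>

lemma countably_compact_base:
  assumes "countably_compact_space TB"
  shows "countably_compact_space T"
  using assms closed_map_corner
  by (rule countably_compact_space_closed_embedding) (auto simp: inj_on_def brandt_elem_eq_iff)

lemma countably_compact_extension:
  assumes "countably_compact_space T" "finite I"
  shows "countably_compact_space TB"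
proof (rule countably_compact_space_finite_cover[OF assms(1), of "I \<times> I" TB "\<lambda>(\<alpha>, \<beta>). el \<alpha> \<beta>"])
  show "topspace TB \<subseteq> (\<Union>j\<in>I \<times> I. (case j of (\<alpha>, \<beta>) \<Rightarrow> el \<alpha> \<beta>) ` topspace T)"
    unfolding TB T by (fastforce elim!: brandt_carrierE)
qed (auto simp: assms continuous_elem)

lemma brandt_base:
  assumes fin: "finite I" and T1: "t1_space T"
    and base: "\<And>s. s \<in> carrier S \<Longrightarrow> base_at_point T s (\<B> s)"
  shows "openin TB = arbitrary union_of (\<lambda>W. W \<in> brandt_base S z I \<B>)"
proof (rule iffD2[OF openin_topology_base_unique], intro conjI allI impI)
  have [simp]: "None \<in> B" by (simp add: brandt_carrier_def)
  have subS: "U \<subseteq> carrier S" "s \<in> U" "openin T U" if "s \<in> carrier S" "U \<in> \<B> s" for s U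
  proof -
    show "openin T U" "s \<in> U" using base[OF that(1)] that(2) by (auto simp: base_at_point_def)
    then show "U \<subseteq> carrier S" using T openin_subset by blast
  qed
  {
    fix W assume "W \<in> brandt_base S z I \<B>"
    then obtain t where t: "t \<in> B" and W: "W \<in> brandt_base_at z I \<B> t"
      by (auto simp: brandt_base_def)
    show "openin TB W"
    proof (cases t)
      case None
      then obtain U where U: "U \<in> \<B> z" and W: "W = (\<Union>\<alpha>\<in>I. \<Union>\<beta>\<in>I. el \<alpha> \<beta> ` U)"
        using W by (auto simp: brandt_base_at_def brandt_block_eq)
      have "{s \<in> carrier S. el \<alpha> \<beta> s \<in> W} = U" if "\<alpha> \<in> I" "\<beta> \<in> I" for \<alpha> \<beta>
        using subS[OF _ U] that I by (auto simp: W brandt_elem_eq_iff image_iff)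
      moreover have "W \<subseteq> B" using subS[OF _ U] by (auto simp: W elem_closed)
      ultimately show ?thesis
        using subS[OF _ U] by (simp add: openin_iff_brandt_open[OF fin] brandt_open_def)
    next
      case (Some p)
      then obtain \<gamma> s \<delta> where s: "t = Some (\<gamma>, s, \<delta>)" "\<gamma> \<in> I" "\<delta> \<in> I" "s \<in> carrier S" "s \<noteq> z"
        using t by (auto simp: brandt_carrier_def)
      then obtain U where U: "U \<in> \<B> s" and W: "W = el \<gamma> \<delta> ` U - {None}"
        using W by (auto simp: brandt_base_at_def brandt_block_eq)
      \<comment> \<open>Removing \<open>None\<close> from \<open>W\<close> removes \<open>z\<close>
        from the trace, which stays open because points of \<open>T\<close> are closed; it also
        empties the traces on all other blocks.\<close>
      have "{s \<in> carrier S. el \<alpha> \<beta> s \<in> W} = (if \<alpha> = \<gamma> \<and> \<beta> = \<delta> then U - {z} else {})" for \<alpha> \<beta>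
        using subS[OF s(4) U] by (auto simp: W brandt_elem_eq_iff image_iff)
      moreover have "W \<subseteq> B" using subS[OF s(4) U] s by (auto simp: W elem_closed)
      moreover have "openin T (U - {z})"
        using subS[OF s(4) U] T1 by (metis closedin_t1_singleton T openin_diff zero_closed)
      ultimately show ?thesis
        by (simp add: openin_iff_brandt_open[OF fin] brandt_open_def)
    qed
  }
  fix V x assume Vx: "openin TB V \<and> x \<in> V"
  then have V: "brandt_open S z T I V" by (simp add: openin_iff_brandt_open[OF fin])
  then have xB: "x \<in> B" using Vx by (auto simp: brandt_open_def)
  have "\<exists>W\<in>brandt_base_at z I \<B> x. x \<in> W \<and> W \<subseteq> V"
  proof (cases x)
    case None
    \<comment> \<open>A basic neighbourhood of zero uses one \<open>U\<close> for all blocks, so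
      \<open>U\<close> must fit inside every trace of \<open>V\<close>; the finite intersection of
      these traces is open.\<close>
    let ?P = "\<Inter>\<alpha>\<in>I. \<Inter>\<beta>\<in>I. {s \<in> carrier S. el \<alpha> \<beta> s \<in> V}"
    have "openin T ?P"
      using V fin I by (intro openin_INT2) (auto simp: brandt_open_def)
    moreover have "z \<in> ?P" using Vx None by simp
    ultimately obtain U where U: "U \<in> \<B> z" "U \<subseteq> ?P"
      using base[OF zero_closed] unfolding base_at_point_def by meson
    let ?W = "\<Union>\<alpha>\<in>I. \<Union>\<beta>\<in>I. el \<alpha> \<beta> ` U"
    have w1: "None \<in> ?W" using subS[OF _ U(1)] I by (auto simp: image_iff)
    have w2: "?W \<subseteq> V" using U(2) by auto
    have w3: "?W \<in> brandt_base_at z I \<B> None"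
      using U(1) by (auto simp: brandt_base_at_def brandt_block_eq)
    show ?thesis unfolding None by (intro bexI[OF _ w3] conjI w1 w2)
  next
    case (Some p)
    then obtain \<gamma> s \<delta> where s: "x = Some (\<gamma>, s, \<delta>)" "\<gamma> \<in> I" "\<delta> \<in> I" "s \<in> carrier S" "s \<noteq> z"
      using xB by (auto simp: brandt_carrier_def)
    then have x: "x = el \<gamma> \<delta> s" by (simp add: brandt_elem_def)
    then obtain U where U: "U \<in> \<B> s" "U \<subseteq> {s \<in> carrier S. el \<gamma> \<delta> s \<in> V}"
      using base[OF s(4)] V s Vx unfolding base_at_point_def brandt_open_def by blast
    let ?W = "el \<gamma> \<delta> ` U - {None}"
    have w1: "x \<in> ?W" using subS[OF s(4) U(1)] x s by auto
    have w2: "?W \<subseteq> V" using U(2) by auto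
    have w3: "?W \<in> brandt_base_at z I \<B> x"
      using U(1) s by (auto simp: brandt_base_at_def brandt_block_eq)
    show ?thesis by (intro bexI[OF _ w3] conjI w1 w2)
  qed
  then show "\<exists>W. W \<in> brandt_base S z I \<B> \<and> x \<in> W \<and> W \<subseteq> V"
    using xB by (auto simp: brandt_base_def)
qed

end

section \<open>Existence of the extension\<close>

lemma istopology_brandt_open: "istopology (brandt_open S z T I)"
  unfolding istopology_def
proof (intro conjI allI impI)
  fix V W assume VW: "brandt_open S z T I V" "brandt_open S z T I W"
  have "{s \<in> carrier S. brandt_elem z \<alpha> \<beta> s \<in> V \<inter> W} =
      {s \<in> carrier S. brandt_elem z \<alpha> \<beta> s \<in> V} \<inter> {s \<in> carrier S. brandt_elem z \<alpha> \<beta> s \<in> W}" for \<alpha> \<beta>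
    by blast
  then show "brandt_open S z T I (V \<inter> W)"
    using VW unfolding brandt_open_def by (auto intro!: openin_Int)
next
  fix \<V> assume \<V>: "\<forall>V\<in>\<V>. brandt_open S z T I V"
  have "{s \<in> carrier S. brandt_elem z \<alpha> \<beta> s \<in> \<Union>\<V>} =
      (\<Union>V\<in>\<V>. {s \<in> carrier S. brandt_elem z \<alpha> \<beta> s \<in> V})" for \<alpha> \<beta>
    by blast
  moreover have "openin T (\<Union>V\<in>\<V>. {s \<in> carrier S. brandt_elem z \<alpha> \<beta> s \<in> V})"
    if "\<alpha> \<in> I" "\<beta> \<in> I" for \<alpha> \<beta>
    using \<V> that by (intro openin_Union) (auto simp: brandt_open_def)
  moreover have "\<Union>\<V> \<subseteq> brandt_carrier S z I" using \<V> by (auto simp: brandt_open_def)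
  ultimately show "brandt_open S z T I (\<Union>\<V>)" by (simp add: brandt_open_def)
qed

locale finite_brandt = monoid_zero S z I
  for S :: "('a, 'm) monoid_scheme" and z :: 'a and I :: "'i set" +
  fixes T :: "'a topology"
  assumes T: "topspace T = carrier S"
    and TIS: "topological_inverse_semigroup T (mult S)"
    and fin: "finite I"
begin

definition TB :: "('i, 'a) brandt topology" where
  "TB = topology (brandt_open S z T I)"

lemma openin_TB: "openin TB V \<longleftrightarrow> brandt_open S z T I V"
  by (simp add: TB_def topology_inverse' istopology_brandt_open)

lemma TS: "topological_semigroup T (mult S)"
  using TIS by (simp add: topological_inverse_semigroup_def)

lemma Hausdorff: "Hausdorff_space T"
  using TS by (simp add: topological_semigroup_def)

lemma topspace_TB: "topspace TB = B"
proof
  show "topspace TB \<subseteq> B" by (auto simp: topspace_def openin_TB brandt_open_def)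
  have "{s \<in> carrier S. el \<alpha> \<beta> s \<in> B} = carrier S" if "\<alpha> \<in> I" "\<beta> \<in> I" for \<alpha> \<beta>
    using that by (auto simp: elem_closed)
  then have "openin TB B" by (simp add: openin_TB brandt_open_def flip: T)
  then show "B \<subseteq> topspace TB" by (rule openin_subset)
qed

lemma continuous_elem: "\<alpha> \<in> I \<Longrightarrow> \<beta> \<in> I \<Longrightarrow> continuous_map T TB (el \<alpha> \<beta>)"
  by (auto simp: continuous_map T topspace_TB openin_TB brandt_open_def elem_closed)

text \<open>The universal property of the final topology.\<close>

lemma continuous_from_TB:
  assumes f: "\<And>\<alpha> \<beta>. \<alpha> \<in> I \<Longrightarrow> \<beta> \<in> I \<Longrightarrow> continuous_map T Y (f \<circ> el \<alpha> \<beta>)"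
  shows "continuous_map TB Y f"
  unfolding continuous_map
proof (intro conjI allI impI)
  show "f ` topspace TB \<subseteq> topspace Y"
    unfolding topspace_TB
    using continuous_map_image_subset_topspace[OF f] T by (fastforce elim!: brandt_carrierE)
  fix U assume U: "openin Y U"
  have "openin T {s \<in> carrier S. el \<alpha> \<beta> s \<in> {x \<in> topspace TB. f x \<in> U}}"
    if "\<alpha> \<in> I" "\<beta> \<in> I" for \<alpha> \<beta>
  proof -
    have "{s \<in> carrier S. el \<alpha> \<beta> s \<in> {x \<in> topspace TB. f x \<in> U}} =
        {s \<in> topspace T. (f \<circ> el \<alpha> \<beta>) s \<in> U}"
      using that by (auto simp: topspace_TB T elem_closed)
    then show ?thesis using openin_continuous_map_preimage[OF f[OF that] U] by simp
  qed
  then show "openin TB {x \<in> topspace TB. f x \<in> U}"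
    by (auto simp: openin_TB brandt_open_def topspace_TB)
qed

lemma continuous_coord: "continuous_map TB T (co \<alpha> \<beta>)"
proof (rule continuous_from_TB)
  fix \<gamma> \<delta> show "continuous_map T T (co \<alpha> \<beta> \<circ> el \<gamma> \<delta>)"
    by (cases "\<gamma> = \<alpha> \<and> \<delta> = \<beta>") (auto simp: o_def brandt_coord_elem T)
qed

text \<open>The continuous coordinates separate points, so disjoint neighbourhoods can be pulled
  back from \<open>T\<close>.\<close>

lemma Hausdorff_TB: "Hausdorff_space TB"
  unfolding Hausdorff_space_def
proof (intro allI impI, elim conjE)
  fix x y assume xy: "x \<in> topspace TB" "y \<in> topspace TB" "x \<noteq> y"
  have "\<exists>\<alpha> \<beta>. co \<alpha> \<beta> x \<noteq> co \<alpha> \<beta> y"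
  proof (rule ccontr)
    assume "\<not> ?thesis"
    then have *: "co \<alpha> \<beta> x = co \<alpha> \<beta> y" for \<alpha> \<beta> by simp
    from xy obtain \<alpha> s \<beta> \<gamma> t \<delta> where x: "x = el \<alpha> \<beta> s" and y: "y = el \<gamma> \<delta> t"
      unfolding topspace_TB by (metis brandt_carrierE)
    \<comment> \<open>It is enough to compare the coordinates at the indices of \<open>x\<close> and
      at those of \<open>y\<close>.\<close>
    show False
      using xy(3) *[of \<alpha> \<beta>] *[of \<gamma> \<delta>] unfolding x y
      by (auto simp: brandt_coord_elem brandt_elem_eq_iff split: if_splits)
  qed
  then obtain \<alpha> \<beta> where ne: "co \<alpha> \<beta> x \<noteq> co \<alpha> \<beta> y" by blast
  then obtain U V where UV: "openin T U" "openin T V" "co \<alpha> \<beta> x \<in> U" "co \<alpha> \<beta> y \<in> V" "disjnt U V"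
    using Hausdorff xy coord_closed T topspace_TB unfolding Hausdorff_space_def by metis
  let ?p = "\<lambda>U. {w \<in> topspace TB. co \<alpha> \<beta> w \<in> U}"
  have "openin TB (?p U)" "openin TB (?p V)"
    using UV openin_continuous_map_preimage[OF continuous_coord] by blast+
  moreover have "x \<in> ?p U" "y \<in> ?p V" "disjnt (?p U) (?p V)"
    using xy UV by (auto simp: disjnt_iff)
  ultimately show "\<exists>U V. openin TB U \<and> openin TB V \<and> x \<in> U \<and> y \<in> V \<and> disjnt U V" by blast
qed

lemma elem_coord: "x \<in> el \<alpha> \<beta> ` A \<Longrightarrow> el \<alpha> \<beta> (co \<alpha> \<beta> x) = x"
  by (auto simp: brandt_coord_elem)

text \<open>The block is the fixed-point set of the continuous retraction
  \<open>el \<alpha> \<beta> \<circ> co \<alpha> \<beta>\<close> in a Hausdorff space.\<close>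

lemma closedin_block:
  assumes "\<alpha> \<in> I" "\<beta> \<in> I"
  shows "closedin TB (el \<alpha> \<beta> ` carrier S)"
proof -
  have "x \<in> el \<alpha> \<beta> ` carrier S" if "x \<in> B" "el \<alpha> \<beta> (co \<alpha> \<beta> x) = x" for x
    using that by (metis coord_closed imageI)
  moreover have "el \<alpha> \<beta> ` carrier S \<subseteq> B" using assms by (auto simp: elem_closed)
  ultimately have "el \<alpha> \<beta> ` carrier S = {x \<in> topspace TB. (el \<alpha> \<beta> \<circ> co \<alpha> \<beta>) x = x}"
    using elem_coord unfolding topspace_TB o_def by blast
  moreover have "closedin TB {x \<in> topspace TB. (el \<alpha> \<beta> \<circ> co \<alpha> \<beta>) x = x}"
    by (intro closedin_continuous_maps_eq[OF Hausdorff_TB]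
        continuous_map_compose[OF continuous_coord continuous_elem] assms) simp
  ultimately show ?thesis by simp
qed

text \<open>Products of two blocks form a finite closed cover of the square, and the multiplication
  is pasted from its restrictions to them.\<close>

lemma continuous_mult: "continuous_map (prod_topology TB TB) TB (\<lambda>(x, y). bm x y)"
proof -
  define K where "K = (\<lambda>((\<alpha>, \<beta>), (\<gamma>, \<delta>)). (el \<alpha> \<beta> ` carrier S) \<times> (el \<gamma> \<delta> ` carrier S))"
  let ?m = "\<lambda>(x, y). bm x y" and ?X = "prod_topology TB TB" and ?J = "(I \<times> I) \<times> (I \<times> I)"
  have K: "closedin ?X (K i) \<and> continuous_map (subtopology ?X (K i)) TB ?m" if "i \<in> ?J" for i
  proof -
    from that obtain \<alpha> \<beta> \<gamma> \<delta>
      where i: "i = ((\<alpha>, \<beta>), (\<gamma>, \<delta>))" "\<alpha> \<in> I" "\<beta> \<in> I" "\<gamma> \<in> I" "\<delta> \<in> I"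
      by auto
    \<comment> \<open>Computed through coordinates, \<open>?g\<close> is continuous on the whole
      square; agreement with the multiplication is claimed only on \<open>K i\<close>.\<close>
    let ?g = "\<lambda>p. if \<beta> = \<gamma> then el \<alpha> \<delta> (co \<alpha> \<beta> (fst p) \<otimes>\<^bsub>S\<^esub> co \<gamma> \<delta> (snd p)) else None"
    have "continuous_map ?X T (\<lambda>p. co \<alpha> \<beta> (fst p) \<otimes>\<^bsub>S\<^esub> co \<gamma> \<delta> (snd p))"
      using continuous_map_semigroup_mult[OF TS
          continuous_map_compose[OF continuous_map_fst continuous_coord]
          continuous_map_compose[OF continuous_map_snd continuous_coord]]
      by (simp add: o_def)
    from continuous_map_compose[OF this continuous_elem[OF i(2,5)]]
    have "continuous_map ?X TB ?g"
      by (cases "\<beta> = \<gamma>") (auto simp: o_def topspace_TB brandt_carrier_def)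
    then have "continuous_map (subtopology ?X (K i)) TB ?g"
      by (rule continuous_map_from_subtopology)
    then have "continuous_map (subtopology ?X (K i)) TB ?m"
      by (rule continuous_map_eq) (auto simp: K_def i(1) brandt_coord_elem mult_elem)
    moreover have "closedin ?X (K i)"
      using i by (simp add: K_def closedin_prod_Times_iff closedin_block)
    ultimately show ?thesis by simp
  qed
  have cover: "\<exists>i\<in>?J. p \<in> K i" if p: "p \<in> topspace ?X" for p
  proof -
    obtain x y where xy: "p = (x, y)" "x \<in> B" "y \<in> B" using p by (auto simp: topspace_TB)
    obtain \<alpha> s \<beta> where "\<alpha> \<in> I" "\<beta> \<in> I" "s \<in> carrier S" "x = el \<alpha> \<beta> s"
      using xy(2) by (rule brandt_carrierE)
    moreover obtain \<gamma> t \<delta> where "\<gamma> \<in> I" "\<delta> \<in> I" "t \<in> carrier S" "y = el \<gamma> \<delta> t"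
      using xy(3) by (rule brandt_carrierE)
    ultimately show ?thesis
      using xy(1) by (intro bexI[of _ "((\<alpha>, \<beta>), (\<gamma>, \<delta>))"]) (auto simp: K_def)
  qed
  show ?thesis
  proof (rule pasting_lemma_closed[where I = ?J and T = K and f = "\<lambda>_. ?m"])
    show "finite ?J" using fin by simp
  qed (use K cover in blast)+
qed

lemma continuous_inversion: "continuous_map TB TB (inversion_on B bm)"
proof (rule continuous_from_TB)
  fix \<alpha> \<beta> assume ab: "\<alpha> \<in> I" "\<beta> \<in> I"
  have inv: "inverse_semigroup_on (carrier S) (mult S)"
    and cinv: "continuous_map T T (inversion_on (carrier S) (mult S))"
    using TIS T by (auto simp: topological_inverse_semigroup_def)
  from continuous_map_compose[OF cinv continuous_elem[OF ab(2,1)]]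
  show "continuous_map T TB (inversion_on B bm \<circ> el \<alpha> \<beta>)"
    by (rule continuous_map_eq) (simp add: T inversion_on_elem[OF inv ab])
qed

lemma topological_inverse_semigroup_TB: "topological_inverse_semigroup TB bm"
  using TIS
  by (auto simp: topological_inverse_semigroup_def topological_semigroup_def topspace_TB T
      Hausdorff_TB semigroup_on_brandt continuous_mult continuous_inversion
      inverse_semigroup_on_brandt)

lemma homeomorphic_map_embed:
  assumes "\<alpha> \<in> I"
  shows "homeomorphic_map T (subtopology TB (brandt_block z (carrier S) \<alpha> \<alpha>)) (brandt_embed z \<alpha>)"
  unfolding homeomorphic_map_maps homeomorphic_maps_def brandt_embed_eq brandt_block_eq
  using assms
  \<comment> \<open>The inverse homeomorphism is the coordinate map restricted to the diagonal
    block.\<close>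
  by (intro exI[of _ "co \<alpha> \<alpha>"])
    (auto simp: continuous_map_in_subtopology continuous_elem T brandt_coord_elem
      intro!: continuous_map_from_subtopology continuous_coord)

lemma topological_brandt_extension_TB: "topological_brandt_extension S z T I TB"
  using mz T TIS TS I
  by (auto simp: topological_brandt_extension_def topological_monoid_with_zero_def topspace_TB
      topological_inverse_semigroup_TB homeomorphic_map_embed)

end

lemma brandt_extensionE:
  assumes "topological_brandt_extension S z T I TB"
  obtains \<alpha>0 where "brandt_extension S z I T TB \<alpha>0"
  using assms
  unfolding topological_brandt_extension_def topological_monoid_with_zero_def
    brandt_extension_def brandt_extension_axioms_def monoid_zero_def by blast

theorem proposition5p9:
  fixes S :: "('a, 'm) monoid_scheme" and z :: 'a and T :: "'a topology" and I :: "'i set"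
  assumes "topological_monoid_with_zero S z T"
    and "I \<noteq> {}"
  shows
    "(\<forall>TB. topological_brandt_extension S z T I TB \<and> (carrier S \<noteq> {z} \<or> finite I) \<longrightarrow>
        (countably_compact_space TB \<longleftrightarrow>
           finite I \<and> countably_compact_space T \<and> topological_inverse_semigroup T (mult S)))
     \<and>
     (countably_compact_space T \<and> topological_inverse_semigroup T (mult S) \<and> finite I \<longrightarrow>
        (\<exists>!TB. topological_brandt_extension S z T I TB \<and> countably_compact_space TB) \<and>
        (\<forall>TB \<B>. topological_brandt_extension S z T I TB \<and> countably_compact_space TB \<and>
             (\<forall>s\<in>carrier S. base_at_point T s (\<B> s)) \<longrightarrow>
           openin TB = arbitrary union_of (\<lambda>W. W \<in> brandt_base S z I \<B>)))"
proof (intro conjI allI impI; (elim conjE)?)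
  fix TB
  assume ext: "topological_brandt_extension S z T I TB" and nt: "carrier S \<noteq> {z} \<or> finite I"
  obtain \<alpha>0 where "brandt_extension S z I T TB \<alpha>0" using ext by (rule brandt_extensionE)
  then interpret brandt_extension S z I T TB \<alpha>0 .
  have "topological_inverse_semigroup T (mult S)"
    using ext by (simp add: topological_brandt_extension_def)
  then show "countably_compact_space TB \<longleftrightarrow>
      finite I \<and> countably_compact_space T \<and> topological_inverse_semigroup T (mult S)"
    using nt finite_if_countably_compact countably_compact_base countably_compact_extension by blast
next
  assume cc: "countably_compact_space T" and TIS: "topological_inverse_semigroup T (mult S)"
    and fin: "finite I"
  interpret finite_brandt S z I T
    using assms TIS fin by unfold_locales (auto simp: topological_monoid_with_zero_def)
  \<comment> \<open>Every extension has the open sets described by \<open>brandt_open\<close>, so it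
    coincides with the constructed \<open>TB\<close>; this is the uniqueness.\<close>
  have open_iff: "openin X = brandt_open S z T I" if X: "topological_brandt_extension S z T I X" for X
  proof -
    obtain \<alpha>0 where "brandt_extension S z I T X \<alpha>0" using X by (rule brandt_extensionE)
    then show ?thesis by (intro ext brandt_extension.openin_iff_brandt_open fin)
  qed
  show "\<exists>!TB. topological_brandt_extension S z T I TB \<and> countably_compact_space TB"
  proof (rule ex1I)
    obtain \<alpha>0 where "brandt_extension S z I T TB \<alpha>0"
      using topological_brandt_extension_TB by (rule brandt_extensionE)
    then have "countably_compact_space TB"
      using cc fin by (rule brandt_extension.countably_compact_extension)
    then show "topological_brandt_extension S z T I TB \<and> countably_compact_space TB"
      using topological_brandt_extension_TB by simp
    fix X assume "topological_brandt_extension S z T I X \<and> countably_compact_space X"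
    then show "X = TB" using open_iff topological_brandt_extension_TB by (metis openin_inject)
  qed
next
  fix TB \<B>
  assume fin: "finite I" and inv: "topological_inverse_semigroup T (mult S)"
    and ext: "topological_brandt_extension S z T I TB"
    and base: "\<forall>s\<in>carrier S. base_at_point T s (\<B> s)"
  obtain \<alpha>0 where "brandt_extension S z I T TB \<alpha>0" using ext by (rule brandt_extensionE)
  then interpret brandt_extension S z I T TB \<alpha>0 .
  \<comment> \<open>Closed points are what the base at nonzero elements requires, where zero is cut
    out of a block.\<close>
  have "t1_space T"
    using inv Hausdorff_imp_t1_space
    by (auto simp: topological_inverse_semigroup_def topological_semigroup_def)
  then show "openin TB = arbitrary union_of (\<lambda>W. W \<in> brandt_base S z I \<B>)"
    using fin base by (intro brandt_base) auto
qed

end
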